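(* Let $u$ be a nontrivial solution of the KP-II equation $(-4u_t+u_{xxx}+6uu_x)_x+3u_{yy}=0$ of the form $u(t,x,y)=2\partial_x^2F(\Theta(t,x,y))$, where $F$ is a smooth profile with $F(1)=0$, $F'(1)=1$, $F''(1)=-1$, $F'''(1)=2$, and where the smooth phase $\Theta>0$ is a solution to $H(\Theta)=Ai(\Theta)=W_y(\Theta)=0$ on $\mathbb R^3$. Then $F=\log$ and $u=Q_k$ for some $k\in\mathbb R\setminus\{0\}$, where $Q_k(t,x):=2k^2\operatorname{sech}^2(kx+k^3t)$.
   Context: Setting: $(t,x,y)\in\mathbb R^3$ and $u$ is real valued. For some $s_0>0$ the profile $F:[s_0,\infty)\to\mathbb R$ and the phase $\Theta=\Theta(t,x,y)\in[s_0,\infty)$ are smooth; the convention is $s_0=1$ (without loss of generality). For $u=2\partial_x^2F(\Theta)$ the KP-II equation is used in its twice-integrated form (obtained assuming convergence to zero at infinity): with $f=F(\Theta)$, $-4\partial_t\partial_x f+\partial_x^4 f+6(\partial_x^2 f)^2+3\partial_y^2 f=0$. Operators: $H(\Theta):=\Theta_y-\Theta_{xx}$, $Ai(\Theta):=\Theta_t-\Theta_{xxx}$, $W_y(\Theta):=\Theta_{yy}-\Theta_y^2/\Theta$.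
   Formalization: u = Q_k is proved up to a translation in x, u(t,x,y) = Q_k(t, x-x_0), since F = log with Θ = e^y cosh(x+t+1) refutes the literal claim; KP-II is also assumed in its twice-integrated form for F(Θ), as in the setting. *)

theory Defs
  imports "HOL-Analysis.Analysis"
begin

text \<open>
  Class \<open>C\<close> to the \<open>k\<close> on an open set: all iterated directional derivatives up to order \<open>k\<close>
  exist (as Frechet derivatives) and are continuous.
\<close>

primrec C_k_on :: "nat \<Rightarrow> 'a::real_normed_vector set \<Rightarrow> ('a \<Rightarrow> 'b::real_normed_vector) \<Rightarrow> bool" where
  "C_k_on 0 S f \<longleftrightarrow> continuous_on S f"
| "C_k_on (Suc k) S f \<longleftrightarrow>
     (\<forall>p\<in>S. f differentiable (at p)) \<and>
     (\<forall>v. C_k_on k S (\<lambda>p. frechet_derivative f (at p) v))"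

definition smooth_on :: "'a::real_normed_vector set \<Rightarrow> ('a \<Rightarrow> 'b::real_normed_vector) \<Rightarrow> bool" where
  "smooth_on S f \<longleftrightarrow> (\<forall>k. C_k_on k S f)"

text \<open>Functions on space-time take their arguments in the order \<open>t\<close>, \<open>x\<close>, \<open>y\<close>.\<close>

type_synonym field3 = "real \<Rightarrow> real \<Rightarrow> real \<Rightarrow> real"

definition smooth3 :: "field3 \<Rightarrow> bool" where
  "smooth3 g \<longleftrightarrow> smooth_on UNIV (\<lambda>(t, x, y). g t x y)"

definition Dt :: "field3 \<Rightarrow> field3" where
  "Dt g = (\<lambda>t x y. deriv (\<lambda>s. g s x y) t)"

definition Dx :: "field3 \<Rightarrow> field3" where
  "Dx g = (\<lambda>t x y. deriv (\<lambda>s. g t s y) x)"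

definition Dy :: "field3 \<Rightarrow> field3" where
  "Dy g = (\<lambda>t x y. deriv (\<lambda>s. g t x s) y)"

definition heat_op :: "field3 \<Rightarrow> field3" where
  "heat_op \<Theta> = (\<lambda>t x y. Dy \<Theta> t x y - (Dx ^^ 2) \<Theta> t x y)"

definition airy_op :: "field3 \<Rightarrow> field3" where
  "airy_op \<Theta> = (\<lambda>t x y. Dt \<Theta> t x y - (Dx ^^ 3) \<Theta> t x y)"

definition Wy_op :: "field3 \<Rightarrow> field3" where
  "Wy_op \<Theta> = (\<lambda>t x y. (Dy ^^ 2) \<Theta> t x y - (Dy \<Theta> t x y)\<^sup>2 / \<Theta> t x y)"

definition KP_II :: "field3 \<Rightarrow> bool" where
  "KP_II u \<longleftrightarrow>
     (\<forall>t x y. Dx (\<lambda>t x y. - 4 * Dt u t x y + (Dx ^^ 3) u t x y + 6 * u t x y * Dx u t x y) t x y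
              + 3 * (Dy ^^ 2) u t x y = 0)"

text \<open>
  The equation for a potential \<open>f\<close> with \<open>u = 2 f\<^sub>x\<^sub>x\<close>: substituting into KP-II gives twice the
  second \<open>x\<close>-derivative of the left-hand side below, and the two integration functions are
  taken to be zero.
\<close>

definition KP_II_integrated :: "field3 \<Rightarrow> bool" where
  "KP_II_integrated f \<longleftrightarrow>
     (\<forall>t x y. - 4 * Dt (Dx f) t x y + (Dx ^^ 4) f t x y + 6 * ((Dx ^^ 2) f t x y)\<^sup>2
              + 3 * (Dy ^^ 2) f t x y = 0)"

definition sech :: "real \<Rightarrow> real" where
  "sech z = 1 / cosh z"

definition Q :: "real \<Rightarrow> real \<Rightarrow> real \<Rightarrow> real" where
  "Q k t x = 2 * k\<^sup>2 * (sech (k * x + k ^ 3 * t))\<^sup>2"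

end

theory Submission
  imports Defs
begin

text \<open>
  For a positive phase, \<open>W\<^sub>y(\<Theta>) = 0\<close> says that \<open>ln \<Theta>\<close> is affine in \<open>y\<close>, so that
  \<open>\<Theta> = A(t, x) exp(b(t, x) y)\<close>. Inserting this into the heat equation gives, after division
  by \<open>\<Theta>\<close>, a polynomial identity in \<open>y\<close> whose quadratic coefficient is \<open>b\<^sub>x\<^sup>2\<close>; hence \<open>b\<close> depends on
  \<open>t\<close> only. The Airy equation then removes the dependence on \<open>t\<close> and becomes the transport
  equation \<open>\<Theta>\<^sub>t = \<kappa> \<Theta>\<^sub>x\<close> with \<open>\<kappa> = b\<close>. Altogether (\<open>phase_separates\<close>)
  \<open>\<Theta> = B(x + \<kappa> t) exp(\<kappa> y)\<close> with \<open>B > 0\<close> and \<open>B'' = \<kappa> B\<close>. A positive function on the line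
  solves this equation only for \<open>\<kappa> \<ge> 0\<close>, and for \<open>\<kappa> = 0\<close> only if it is constant, in which case
  \<open>u = 0\<close>. So \<open>\<kappa> = c\<^sup>2\<close> with \<open>c > 0\<close> and \<open>B(x) = a exp(c x) + b exp(-c x)\<close> with \<open>a, b \<ge> 0\<close>
  (\<open>positive_hyperbolic_solution\<close>). Since \<open>exp(\<kappa> y)\<close> runs through all positive numbers, the
  phase has range \<open>(0, \<infinity>)\<close>, and the equation for the potential \<open>F(\<Theta>)\<close> becomes a family of
  ordinary differential equations for \<open>F\<close> on the whole half-line
  (\<open>separated_phase_potential_equation\<close>).

  If \<open>a\<close> or \<open>b\<close> vanishes, then \<open>\<Theta>\<close> is a single exponential. In the variable \<open>\<theta> = ln s\<close> the function
  \<open>v = (d/d\<theta>)\<^sup>2 F(exp \<theta>)\<close> satisfies \<open>v'' = v - 6 v\<^sup>2\<close>, and the initial conditions on \<open>F\<close> give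
  \<open>v = v' = 0\<close> at \<open>\<theta> = 0\<close>. By uniqueness \<open>v = 0\<close> (\<open>logarithmic_soliton_ode_trivial\<close>), and
  \<open>u = 2 \<kappa> v(\<Theta>)\<close> would be trivial.

  Hence \<open>a, b > 0\<close> and \<open>B\<close> is a multiple of \<open>cosh(c (x - x\<^sub>0))\<close>. At a point where \<open>\<Theta>\<^sub>x = 0\<close> the
  third and fourth derivatives of \<open>F\<close> drop out of the equation, which reduces to the Riccati
  equation \<open>F'' = -(F')\<^sup>2\<close>; such points realise every value of \<open>\<Theta>\<close>. With \<open>F(1) = 0\<close>,
  \<open>F'(1) = 1\<close> this forces \<open>F = ln\<close> (\<open>riccati_profile_is_ln\<close>), and
  \<open>u = 2 (ln cosh(c (x - x\<^sub>0) + c\<^sup>3 t))\<^sub>x\<^sub>x\<close> is the line soliton.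
\<close>


section \<open>Partial derivatives of smooth functions\<close>

lemma C_k_on_cong:
  assumes "open S" "\<And>p. p \<in> S \<Longrightarrow> f p = g p" "C_k_on k S f"
  shows "C_k_on k S g"
  using assms(2,3)
proof (induction k arbitrary: f g)
  case 0
  then show ?case by (metis C_k_on.simps(1) continuous_on_cong)
next
  case (Suc k)
  have D: "(g has_derivative frechet_derivative f (at p)) (at p)" if "p \<in> S" for p
  proof (rule has_derivative_transform_within_open[OF _ assms(1) that Suc.prems(1)])
    show "(f has_derivative frechet_derivative f (at p)) (at p)"
      using Suc.prems(2) that by (simp add: frechet_derivative_works)
  qed
  have "C_k_on k S (\<lambda>p. frechet_derivative g (at p) v)" for v
  proof (rule Suc.IH)
    show "C_k_on k S (\<lambda>p. frechet_derivative f (at p) v)"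
      using Suc.prems(2) by simp
    show "frechet_derivative f (at p) v = frechet_derivative g (at p) v" if "p \<in> S" for p
      using frechet_derivative_at[OF D[OF that]] by simp
  qed
  with D show ?case by (auto simp: differentiable_def)
qed

lemma smooth_on_cong:
  assumes "open S" "\<And>p. p \<in> S \<Longrightarrow> f p = g p" "smooth_on S f"
  shows "smooth_on S g"
  using assms C_k_on_cong[of S f g] by (auto simp: smooth_on_def)

lemma smooth_on_differentiable:
  "smooth_on S f \<Longrightarrow> p \<in> S \<Longrightarrow> (f has_derivative frechet_derivative f (at p)) (at p)"
  unfolding smooth_on_def by (metis C_k_on.simps(2) frechet_derivative_works)

lemma smooth_on_directional_derivative:
  "smooth_on S f \<Longrightarrow> smooth_on S (\<lambda>p. frechet_derivative f (at p) v)"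
  unfolding smooth_on_def by (metis C_k_on.simps(2))

lemma smooth_on_has_real_derivative:
  fixes f :: "real \<Rightarrow> real"
  assumes "smooth_on S f" "s \<in> S"
  shows "(f has_real_derivative frechet_derivative f (at s) 1) (at s)"
proof -
  have D: "(f has_derivative frechet_derivative f (at s)) (at s)"
    using smooth_on_differentiable[OF assms] .
  then obtain d where d: "(f has_real_derivative d) (at s)"
    using differentiable_def real_differentiable_def by blast
  then have "frechet_derivative f (at s) = (*) d"
    using frechet_derivative_at by (metis has_field_derivative_def)
  with d show ?thesis by simp
qed

lemma smooth_on_deriv:
  fixes f :: "real \<Rightarrow> real"
  assumes "open S" "smooth_on S f"
  shows "smooth_on S (deriv f)"
  using smooth_on_cong[OF assms(1) _ smooth_on_directional_derivative[OF assms(2), of 1]]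
    smooth_on_has_real_derivative[OF assms(2)] DERIV_imp_deriv by metis

lemma smooth_on_has_iterated_deriv:
  fixes f :: "real \<Rightarrow> real"
  assumes "open S" "smooth_on S f" "s \<in> S"
  shows "((deriv ^^ n) f has_real_derivative (deriv ^^ Suc n) f s) (at s)"
proof -
  have "smooth_on S ((deriv ^^ n) f)"
    by (induction n) (use assms smooth_on_deriv in auto)
  then show ?thesis
    using smooth_on_has_real_derivative assms(3) DERIV_imp_deriv by fastforce
qed

lemma has_real_derivative_along_curve:
  fixes G :: "'a::real_normed_vector \<Rightarrow> real"
  assumes "(G has_derivative D) (at (\<gamma> s))" "(\<gamma> has_vector_derivative v) (at s)"
  shows "((\<lambda>r. G (\<gamma> r)) has_real_derivative D v) (at s)"
proof -
  interpret bounded_linear D using assms(1) by (rule has_derivative_bounded_linear)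
  have "((\<lambda>r. G (\<gamma> r)) has_derivative (\<lambda>h. D (h *\<^sub>R v))) (at s)"
    using has_derivative_compose[OF assms(2)[unfolded has_vector_derivative_def] assms(1)] .
  then show ?thesis
    by (simp add: has_field_derivative_def scaleR mult.commute[of _ "D v"])
qed

text \<open>
  Each partial derivative is the total derivative in a coordinate direction. The derivative
  along a line with velocity \<open>m\<close> is what integrates a transport equation, and needs total
  differentiability rather than the mere existence of partial derivatives.
\<close>

lemma smooth3_partial_derivatives:
  assumes "smooth3 g"
  shows smooth3_Dt: "((\<lambda>s. g s x y) has_real_derivative Dt g t x y) (at t)"
    and smooth3_Dx: "((\<lambda>s. g t s y) has_real_derivative Dx g t x y) (at x)"
    and smooth3_Dy: "((\<lambda>s. g t x s) has_real_derivative Dy g t x y) (at y)"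
    and smooth3_along_line:
      "((\<lambda>s. g s (x0 + m * s) y) has_real_derivative
         Dt g t (x0 + m * t) y + m * Dx g t (x0 + m * t) y) (at t)"
    and smooth3_Dx_smooth: "smooth3 (Dx g)"
    and smooth3_Dy_smooth: "smooth3 (Dy g)"
proof -
  define G where "G = (\<lambda>(t, x, y). g t x y)"
  define D where "D p = frechet_derivative G (at p)" for p
  have sm: "smooth_on UNIV G" using assms by (simp add: smooth3_def G_def)
  have GD: "(G has_derivative D p) (at p)" for p
    unfolding D_def using smooth_on_differentiable[OF sm] by simp
  note curve = has_real_derivative_along_curve[OF GD]
  have t: "((\<lambda>s. g s x y) has_real_derivative D (t, x, y) (1, 0, 0)) (at t)" for t x y
  proof -
    have "((\<lambda>s. (s, x, y)) has_vector_derivative (1, 0, 0)) (at t)"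
      unfolding has_vector_derivative_def
      by (rule derivative_eq_intros refl | simp)+
    from curve[OF this] show ?thesis by (simp add: G_def)
  qed
  have x: "((\<lambda>s. g t s y) has_real_derivative D (t, x, y) (0, 1, 0)) (at x)" for t x y
  proof -
    have "((\<lambda>s. (t, s, y)) has_vector_derivative (0, 1, 0)) (at x)"
      unfolding has_vector_derivative_def
      by (rule derivative_eq_intros refl | simp)+
    from curve[OF this] show ?thesis by (simp add: G_def)
  qed
  have y: "((\<lambda>s. g t x s) has_real_derivative D (t, x, y) (0, 0, 1)) (at y)" for t x y
  proof -
    have "((\<lambda>s. (t, x, s)) has_vector_derivative (0, 0, 1)) (at y)"
      unfolding has_vector_derivative_def
      by (rule derivative_eq_intros refl | simp)+
    from curve[OF this] show ?thesis by (simp add: G_def)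
  qed
  have Dt: "Dt g t x y = D (t, x, y) (1, 0, 0)" for t x y
    unfolding Dt_def using t by (rule DERIV_imp_deriv)
  have Dx: "Dx g t x y = D (t, x, y) (0, 1, 0)" for t x y
    unfolding Dx_def using x by (rule DERIV_imp_deriv)
  have Dy: "Dy g t x y = D (t, x, y) (0, 0, 1)" for t x y
    unfolding Dy_def using y by (rule DERIV_imp_deriv)
  show "((\<lambda>s. g s x y) has_real_derivative Dt g t x y) (at t)"
    "((\<lambda>s. g t s y) has_real_derivative Dx g t x y) (at x)"
    "((\<lambda>s. g t x s) has_real_derivative Dy g t x y) (at y)"
    using t x y by (simp_all add: Dt Dx Dy)
  show "((\<lambda>s. g s (x0 + m * s) y) has_real_derivative
         Dt g t (x0 + m * t) y + m * Dx g t (x0 + m * t) y) (at t)"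
  proof -
    interpret bounded_linear "D (t, x0 + m * t, y)"
      using GD by (rule has_derivative_bounded_linear)
    have "((\<lambda>s. (s, x0 + m * s, y)) has_vector_derivative (1, m, 0)) (at t)"
      unfolding has_vector_derivative_def
      by (rule derivative_eq_intros refl | simp add: mult.commute)+
    from curve[OF this] have "((\<lambda>s. g s (x0 + m * s) y) has_real_derivative
        D (t, x0 + m * t, y) (1, m, 0)) (at t)" by (simp add: G_def)
    moreover have "(1, m, 0) = (1, 0, 0) + m *\<^sub>R (0, 1, 0 :: real)" by simp
    moreover have "D (t, x0 + m * t, y) ((1, 0, 0) + m *\<^sub>R (0, 1, 0))
        = Dt g t (x0 + m * t) y + m * Dx g t (x0 + m * t) y"
      unfolding add scaleR Dt Dx by simp
    ultimately show ?thesis by metis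
  qed
  have "(\<lambda>(t, x, y). Dx g t x y) = (\<lambda>p. D p (0, 1, 0))"
    "(\<lambda>(t, x, y). Dy g t x y) = (\<lambda>p. D p (0, 0, 1))"
    by (auto simp: Dx Dy)
  then show "smooth3 (Dx g)" "smooth3 (Dy g)"
    using smooth_on_directional_derivative[OF sm] by (auto simp: smooth3_def D_def)
qed

lemma Dt_eqI:
  "(\<And>t x y. ((\<lambda>s. g s x y) has_real_derivative g' t x y) (at t)) \<Longrightarrow> Dt g = g'"
  by (intro ext) (simp add: Dt_def DERIV_imp_deriv)

lemma Dx_eqI:
  "(\<And>t x y. ((\<lambda>s. g t s y) has_real_derivative g' t x y) (at x)) \<Longrightarrow> Dx g = g'"
  by (intro ext) (simp add: Dx_def DERIV_imp_deriv)

lemma Dy_eqI: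
  "(\<And>t x y. ((\<lambda>s. g t x s) has_real_derivative g' t x y) (at y)) \<Longrightarrow> Dy g = g'"
  by (intro ext) (simp add: Dy_def DERIV_imp_deriv)


section \<open>Linear ordinary differential equations\<close>

lemma zero_derivative_constant:
  fixes f :: "real \<Rightarrow> real"
  shows "(\<And>x. (f has_real_derivative 0) (at x)) \<Longrightarrow> f x = f y"
  using DERIV_isconst_all by blast

lemma linear_ode_solution:
  fixes h :: "real \<Rightarrow> real"
  assumes "\<And>x. (h has_real_derivative k * h x) (at x)"
  shows "h x = h 0 * exp (k * x)"
proof -
  have "((\<lambda>x. h x * exp (- (k * x))) has_real_derivative 0) (at x)" for x
    by (rule derivative_eq_intros assms refl | simp)+
  from zero_derivative_constant[OF this, of x 0] show ?thesis by (simp add: exp_minus field_simps)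
qed

text \<open>The equation \<open>g'' = (g')\<^sup>2 / g\<close> is \<open>(ln g)'' = 0\<close>: the quotient \<open>g' / g\<close> is constant.\<close>

lemma log_affine_solution:
  fixes g :: "real \<Rightarrow> real"
  assumes pos: "\<And>y. g y > 0"
    and g: "\<And>y. (g has_real_derivative g1 y) (at y)"
    and g1: "\<And>y. (g1 has_real_derivative (g1 y)\<^sup>2 / g y) (at y)"
  shows "g y = g 0 * exp (g1 0 / g 0 * y)" "g1 y = g1 0 / g 0 * g y"
proof -
  have nz: "g y \<noteq> 0" for y using pos[of y] by simp
  have "((\<lambda>y. g1 y / g y) has_real_derivative 0) (at y)" for y
    by (rule derivative_eq_intros g g1 refl nz | simp add: nz power2_eq_square)+
  then have "g1 y / g y = g1 0 / g 0" for y
    by (rule zero_derivative_constant)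
  then show *: "g1 y = g1 0 / g 0 * g y" for y
    using nz[of y] by (metis nonzero_eq_divide_eq)
  show "g y = g 0 * exp (g1 0 / g 0 * y)"
  proof (rule linear_ode_solution)
    show "(g has_real_derivative g1 0 / g 0 * g y) (at y)" for y
      using g[of y] unfolding *[of y] .
  qed
qed

text \<open>
  For \<open>\<kappa> = -m\<^sup>2\<close> the Wronskian of \<open>B\<close> with the explicit solution \<open>sin(m x)\<close> is constant, but over
  half a period, from \<open>0\<close> to \<open>\<pi>/m\<close>, it goes from \<open>m B(0) > 0\<close> to \<open>-m B(\<pi>/m) < 0\<close>.
\<close>

lemma positive_solution_eigenvalue_nonneg:
  fixes B :: "real \<Rightarrow> real"
  assumes pos: "\<And>x. B x > 0"
    and B: "\<And>x. (B has_real_derivative B1 x) (at x)"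
    and B1: "\<And>x. (B1 has_real_derivative \<kappa> * B x) (at x)"
  shows "\<kappa> \<ge> 0"
proof (rule ccontr)
  assume "\<not> \<kappa> \<ge> 0"
  define m where "m = sqrt (- \<kappa>)"
  have m: "m > 0" "\<kappa> = - (m * m)" using \<open>\<not> \<kappa> \<ge> 0\<close> by (simp_all add: m_def)
  have "((\<lambda>x. m * B x * cos (m * x) - B1 x * sin (m * x)) has_real_derivative 0) (at x)" for x
    by (rule derivative_eq_intros B B1 refl | simp add: m algebra_simps)+
  from zero_derivative_constant[OF this, of "pi / m" 0] have "m * (B 0 + B (pi / m)) = 0" using m(1) by (simp add: algebra_simps)
  then show False using m(1) pos[of 0] pos[of "pi / m"] by simp
qed

lemma positive_affine_constant:
  fixes B :: "real \<Rightarrow> real"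
  assumes pos: "\<And>x. B x > 0"
    and B: "\<And>x. (B has_real_derivative B1 x) (at x)"
    and B1: "\<And>x. (B1 has_real_derivative 0) (at x)"
  shows "B1 x = 0"
proof -
  have c: "B1 x = B1 0" for x using B1 by (rule zero_derivative_constant)
  have "((\<lambda>x. B x - B1 0 * x) has_real_derivative 0) (at x)" for x
    by (rule derivative_eq_intros B refl | simp add: c[of x])+
  \<comment> \<open>With a nonzero slope, \<open>B\<close> would vanish at \<open>- B 0 / B1 0\<close>.\<close>
  from zero_derivative_constant[OF this, of "- B 0 / B1 0" 0] have "B1 0 = 0"
    using pos[of "- B 0 / B1 0"] by (cases "B1 0 = 0") auto
  then show ?thesis using c by simp
qed

lemma positive_exponential_sum_coeff_nonneg:
  fixes a b c :: real
  assumes pos: "\<And>x. a * exp (c * x) + b * exp (- (c * x)) > 0" and "c \<noteq> 0"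
  shows "a \<ge> 0"
proof (rule ccontr)
  assume "\<not> a \<ge> 0"
  then have a: "a < 0" by simp
  \<comment> \<open>The point is chosen such that \<open>exp (2 * c * x) = E\<close>, which makes
      \<open>a * exp (2 * c * x) + b\<close> negative.\<close>
  define E where "E = (\<bar>b\<bar> + 1) / (- a)"
  define x where "x = ln E / (2 * c)"
  have E: "E > 0" unfolding E_def using a by (intro divide_pos_pos) auto
  have "exp (c * x) * exp (c * x) = exp (c * x + c * x)" by (simp only: exp_add)
  also have "c * x + c * x = ln E" using assms(2) by (simp add: x_def)
  finally have e: "exp (c * x) * exp (c * x) = E" using E by simp
  have "0 < exp (c * x) * (a * exp (c * x) + b * exp (- (c * x)))"
    using pos[of x] by simp
  also have "\<dots> = a * (exp (c * x) * exp (c * x)) + b"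
    by (simp add: exp_minus field_simps)
  also have "\<dots> = - \<bar>b\<bar> - 1 + b" unfolding e E_def using a by (simp add: field_simps)
  finally show False by simp
qed

text \<open>
  Factoring \<open>B'' - c\<^sup>2 B\<close> as a product of first-order operators, \<open>B' + c B\<close> and \<open>B' - c B\<close> are
  pure exponentials. Positivity as \<open>x\<close> tends to either infinity gives the signs of the coefficients.
\<close>

lemma positive_hyperbolic_solution:
  fixes B :: "real \<Rightarrow> real"
  assumes pos: "\<And>x. B x > 0" and c: "c \<noteq> 0"
    and B: "\<And>x. (B has_real_derivative B1 x) (at x)"
    and B1: "\<And>x. (B1 has_real_derivative c\<^sup>2 * B x) (at x)"
  obtains a b where "a \<ge> 0" "b \<ge> 0"
    "\<And>x. B x = a * exp (c * x) + b * exp (- (c * x))"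
    "\<And>x. B1 x = c * (a * exp (c * x) - b * exp (- (c * x)))"
proof -
  have P: "B1 x + c * B x = (B1 0 + c * B 0) * exp (c * x)" for x
    by (rule linear_ode_solution)
      (rule derivative_eq_intros B B1 refl | simp add: power2_eq_square algebra_simps)+
  have R: "B1 x - c * B x = (B1 0 - c * B 0) * exp ((- c) * x)" for x
    by (rule linear_ode_solution)
      (rule derivative_eq_intros B B1 refl | simp add: power2_eq_square algebra_simps)+
  define a where "a = (B1 0 + c * B 0) / (2 * c)"
  define b where "b = (c * B 0 - B1 0) / (2 * c)"
  have a: "B1 x + c * B x = 2 * c * (a * exp (c * x))" for x
    using c by (simp add: P[of x] a_def)
  have b: "B1 x - c * B x = - 2 * c * (b * exp (- (c * x)))" for x
    using c by (simp add: R[of x] b_def minus_mult_left[symmetric] left_diff_distrib)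
  have Beq: "B x = a * exp (c * x) + b * exp (- (c * x))" for x
  proof -
    have "2 * c * B x = 2 * c * (a * exp (c * x) + b * exp (- (c * x)))"
      using a[of x] b[of x] by (simp add: algebra_simps)
    then show ?thesis using c by simp
  qed
  have B1eq: "B1 x = c * (a * exp (c * x) - b * exp (- (c * x)))" for x
    using a[of x] b[of x] by (simp add: algebra_simps)
  have "a \<ge> 0"
    using positive_exponential_sum_coeff_nonneg[of a c b] pos c by (simp add: Beq)
  moreover have "b \<ge> 0"
    using positive_exponential_sum_coeff_nonneg[of b "- c" a] pos c by (simp add: Beq add.commute)
  ultimately show ?thesis using that Beq B1eq by blast
qed


section \<open>The phase is a travelling exponential\<close>

text \<open>
  Comparing the coefficients of \<open>y\<close> in the polynomial identities described at the beginning is done by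
  evaluating at \<open>y = -1, 0, 1\<close>. The function \<open>X\<close> below is \<open>(ln \<Theta>)\<^sub>x\<close>, and the heat equation becomes
  \<open>X\<^sub>x = b - X\<^sup>2\<close>. As \<open>ln \<Theta>\<close> is affine in \<open>y\<close>, so is \<open>X\<close>, and differentiating this relation in
  \<open>x\<close> shows the same for \<open>X\<^sup>2\<close>. A function that is affine together with its square is constant.
\<close>

lemma phase_separates:
  assumes sm: "smooth3 \<Theta>"
    and pos: "\<And>t x y. \<Theta> t x y > 0"
    and heat: "\<And>t x y. heat_op \<Theta> t x y = 0"
    and airy: "\<And>t x y. airy_op \<Theta> t x y = 0"
    and Wy: "\<And>t x y. Wy_op \<Theta> t x y = 0"
  obtains \<kappa> B B1 where
    "\<And>t x y. \<Theta> t x y = B (x + \<kappa> * t) * exp (\<kappa> * y)"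
    "\<And>x. B x > 0"
    "\<And>x. (B has_real_derivative B1 x) (at x)"
    "\<And>x. (B1 has_real_derivative \<kappa> * B x) (at x)"
proof -
  have nz: "\<Theta> t x y \<noteq> 0" for t x y using pos[of t x y] by simp
  have heat': "Dx (Dx \<Theta>) t x y = Dy \<Theta> t x y" for t x y
    using heat[of t x y] by (simp add: heat_op_def numeral_2_eq_2)
  have airy': "Dx (Dx (Dx \<Theta>)) t x y = Dt \<Theta> t x y" for t x y
    using airy[of t x y] by (simp add: airy_op_def numeral_3_eq_3)
  have Wy': "Dy (Dy \<Theta>) t x y = (Dy \<Theta> t x y)\<^sup>2 / \<Theta> t x y" for t x y
    using Wy[of t x y] by (simp add: Wy_op_def numeral_2_eq_2)
  note smx = smooth3_Dx_smooth[OF sm]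
  define b where "b t x = Dy \<Theta> t x 0 / \<Theta> t x 0" for t x
  define X where "X t x y = Dx \<Theta> t x y / \<Theta> t x y" for t x y
  have Dyy: "((\<lambda>y. Dy \<Theta> t x y) has_real_derivative (Dy \<Theta> t x y)\<^sup>2 / \<Theta> t x y) (at y)" for t x y
    using smooth3_Dy[OF smooth3_Dy_smooth[OF sm]] by (simp add: Wy')
  have exp_y: "\<Theta> t x y = \<Theta> t x 0 * exp (b t x * y)" for t x y
    unfolding b_def by (rule log_affine_solution(1)[OF pos smooth3_Dy[OF sm] Dyy])
  have Dy_b: "Dy \<Theta> t x y = b t x * \<Theta> t x y" for t x y
    unfolding b_def by (rule log_affine_solution(2)[OF pos smooth3_Dy[OF sm] Dyy])
  have Lx: "((\<lambda>x. ln (\<Theta> t x y)) has_real_derivative X t x y) (at x)" for t x y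
    unfolding X_def by (rule derivative_eq_intros smooth3_Dx[OF sm] pos refl | simp)+
  have Lt: "((\<lambda>t. ln (\<Theta> t x y)) has_real_derivative Dt \<Theta> t x y / \<Theta> t x y) (at t)" for t x y
    by (rule derivative_eq_intros smooth3_Dt[OF sm] pos refl | simp)+
  have Xx: "((\<lambda>x. X t x y) has_real_derivative b t x - (X t x y)\<^sup>2) (at x)" for t x y
    unfolding X_def
    by (rule derivative_eq_intros smooth3_Dx[OF sm] smooth3_Dx[OF smx] nz refl
        | simp add: heat' Dy_b nz power2_eq_square field_simps)+
  have ln_y: "ln (\<Theta> t x y) = ln (\<Theta> t x 0) + b t x * y" for t x y
    by (subst exp_y) (simp add: ln_mult_pos pos)
  have X_affine: "X t x 1 + X t x (- 1) = 2 * X t x 0" for t x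
  proof (rule DERIV_unique)
    have "(\<lambda>x. 2 * ln (\<Theta> t x 0)) = (\<lambda>x. ln (\<Theta> t x 1) + ln (\<Theta> t x (- 1)))"
      by (rule ext) (subst (2 3) ln_y, simp)
    then show "((\<lambda>x. 2 * ln (\<Theta> t x 0)) has_real_derivative X t x 1 + X t x (- 1)) (at x)"
      using DERIV_add[OF Lx Lx] by simp
    show "((\<lambda>x. 2 * ln (\<Theta> t x 0)) has_real_derivative 2 * X t x 0) (at x)"
      by (rule DERIV_cmult[OF Lx])
  qed
  have X_squares: "(X t x 1)\<^sup>2 + (X t x (- 1))\<^sup>2 = 2 * (X t x 0)\<^sup>2" for t x
  proof -
    have "b t x - (X t x 1)\<^sup>2 + (b t x - (X t x (- 1))\<^sup>2) = 2 * (b t x - (X t x 0)\<^sup>2)"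
    proof (rule DERIV_unique)
      show "((\<lambda>x. 2 * X t x 0) has_real_derivative
          b t x - (X t x 1)\<^sup>2 + (b t x - (X t x (- 1))\<^sup>2)) (at x)"
        unfolding X_affine[symmetric] by (rule DERIV_add[OF Xx Xx])
      show "((\<lambda>x. 2 * X t x 0) has_real_derivative 2 * (b t x - (X t x 0)\<^sup>2)) (at x)"
        by (rule DERIV_cmult[OF Xx])
    qed
    then show ?thesis by simp
  qed
  have X1: "X t x 1 = X t x 0" for t x
  proof -
    have "(X t x 1 - X t x 0)\<^sup>2 = 0"
    proof -
      have m: "X t x (- 1) = 2 * X t x 0 - X t x 1" using X_affine[of t x] by simp
      show ?thesis using X_squares[of t x] unfolding m by (simp add: power2_eq_square algebra_simps)
    qed
    then show ?thesis by simp
  qed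
  \<comment> \<open>This formula makes \<open>b\<close> differentiable in \<open>t\<close> and \<open>x\<close> by first derivatives of \<open>\<Theta>\<close> alone,
      without interchanging mixed partial derivatives.\<close>
  have b_ln: "b t x = ln (\<Theta> t x 1) - ln (\<Theta> t x 0)" for t x
    by (subst ln_y) simp
  have "((\<lambda>x. b t x) has_real_derivative 0) (at x)" for t x
    unfolding b_ln using DERIV_diff[OF Lx[of t 1 x] Lx[of t 0 x]] by (simp add: X1)
  then have bx: "b t x = b t 0" for t x
    by (rule zero_derivative_constant)
  have Dt_b: "Dt \<Theta> t x y = b t 0 * Dx \<Theta> t x y" for t x y
  proof -
    have "Dx (Dx \<Theta>) = (\<lambda>t x y. b t 0 * \<Theta> t x y)"
      by (intro ext) (simp only: heat' Dy_b, metis bx)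
    then have "Dx (Dx (Dx \<Theta>)) t x y = Dx (\<lambda>t x y. b t 0 * \<Theta> t x y) t x y" by simp
    also have "Dx (\<lambda>t x y. b t 0 * \<Theta> t x y) = (\<lambda>t x y. b t 0 * Dx \<Theta> t x y)"
      by (rule Dx_eqI) (rule derivative_eq_intros smooth3_Dx[OF sm] refl | simp)+
    finally show ?thesis by (simp add: airy')
  qed
  \<comment> \<open>Since \<open>X\<close> agrees at \<open>y = 0\<close> and \<open>y = 1\<close>, so does \<open>(ln \<Theta>)\<^sub>t = b * X\<close>, which leaves nothing
      for the derivative of \<open>b\<close>.\<close>
  have "((\<lambda>t. b t 0) has_real_derivative 0) (at t)" for t
  proof -
    have "Dt \<Theta> t 0 1 / \<Theta> t 0 1 - Dt \<Theta> t 0 0 / \<Theta> t 0 0 = b t 0 * (X t 0 1 - X t 0 0)"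
      by (simp add: Dt_b X_def right_diff_distrib)
    then show ?thesis
      unfolding b_ln using DERIV_diff[OF Lt[of 0 1 t] Lt[of 0 0 t]] by (simp add: X1)
  qed
  then have "b t 0 = b 0 0" for t
    by (rule zero_derivative_constant)
  then obtain \<kappa> where \<kappa>: "b t x = \<kappa>" for t x using bx by metis
  have transport: "\<Theta> t x y = \<Theta> 0 (x + \<kappa> * t) y" for t x y
  proof -
    have "((\<lambda>s. \<Theta> s (x + \<kappa> * t + (- \<kappa>) * s) y) has_real_derivative 0) (at s)" for s
      using smooth3_along_line[OF sm, of "x + \<kappa> * t" "- \<kappa>" y s] by (simp add: Dt_b \<kappa>)
    from zero_derivative_constant[OF this, of t 0] show ?thesis by simp
  qed
  show ?thesis
  proof (rule that)
    show "\<Theta> t x y = \<Theta> 0 (x + \<kappa> * t) 0 * exp (\<kappa> * y)" for t x y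
      using transport[of t x y] exp_y[of 0 "x + \<kappa> * t" y] by (simp add: \<kappa>)
    show "((\<lambda>x. \<Theta> 0 x 0) has_real_derivative Dx \<Theta> 0 x 0) (at x)" for x
      by (rule smooth3_Dx[OF sm])
    show "((\<lambda>x. Dx \<Theta> 0 x 0) has_real_derivative \<kappa> * \<Theta> 0 x 0) (at x)" for x
      using smooth3_Dx[OF smx, of 0 0 x] by (simp add: heat' Dy_b \<kappa>)
  qed (rule pos)
qed


section \<open>The potential equation along a separated phase\<close>

text \<open>
  With \<open>Z1 = \<Theta>\<^sub>x\<close>, the phase obeys the closed system \<open>\<Theta>\<^sub>x = Z1\<close>, \<open>Z1\<^sub>x = \<kappa> \<Theta>\<close>, \<open>\<partial>\<^sub>t = \<kappa> \<partial>\<^sub>x\<close>,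
  \<open>\<Theta>\<^sub>y = \<kappa> \<Theta>\<close>. Hence every derivative of \<open>F(\<Theta>)\<close> is a polynomial in \<open>\<Theta>\<close>, \<open>Z1\<close> and the
  derivatives \<open>G n\<close> of \<open>F\<close> at \<open>\<Theta>\<close>.
\<close>

lemma separated_phase_derivatives:
  fixes F :: "real \<Rightarrow> real"
  assumes \<Theta>: "\<And>t x y. \<Theta> t x y = B (x + \<kappa> * t) * exp (\<kappa> * y)"
    and pos: "\<And>x. B x > 0"
    and B: "\<And>x. (B has_real_derivative B1 x) (at x)"
    and B1: "\<And>x. (B1 has_real_derivative \<kappa> * B x) (at x)"
    and F: "\<And>n s. s > 0 \<Longrightarrow> ((deriv ^^ n) F has_real_derivative (deriv ^^ Suc n) F s) (at s)"
    and Z1_def: "\<And>t x y. Z1 t x y = B1 (x + \<kappa> * t) * exp (\<kappa> * y)"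
    and G_def: "\<And>n t x y. G n t x y = (deriv ^^ n) F (\<Theta> t x y)"
  shows separated_phase_Dxx: "(Dx ^^ 2) (\<lambda>t x y. F (\<Theta> t x y)) =
      (\<lambda>t x y. G 2 t x y * (Z1 t x y)\<^sup>2 + \<kappa> * G 1 t x y * \<Theta> t x y)"
    and separated_phase_potential_equation: "KP_II_integrated (\<lambda>t x y. F (\<Theta> t x y)) \<Longrightarrow>
      G 4 t x y * Z1 t x y ^ 4 + 6 * \<kappa> * G 3 t x y * (Z1 t x y)\<^sup>2 * \<Theta> t x y
      + G 2 t x y * (4 * \<kappa> * (Z1 t x y)\<^sup>2 + 3 * \<kappa>\<^sup>2 * (\<Theta> t x y)\<^sup>2)
      + \<kappa>\<^sup>2 * G 1 t x y * \<Theta> t x y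
      - 4 * \<kappa> * (G 2 t x y * (Z1 t x y)\<^sup>2 + \<kappa> * G 1 t x y * \<Theta> t x y)
      + 6 * (G 2 t x y * (Z1 t x y)\<^sup>2 + \<kappa> * G 1 t x y * \<Theta> t x y)\<^sup>2
      + 3 * \<kappa>\<^sup>2 * (G 2 t x y * (\<Theta> t x y)\<^sup>2 + G 1 t x y * \<Theta> t x y) = 0"
proof -
  have \<Theta>pos: "\<Theta> t x y > 0" for t x y by (simp add: \<Theta> pos)
  note chain_B = DERIV_chain2[OF B] DERIV_chain2[OF B1]
  have Z_t: "((\<lambda>s. \<Theta> s x y) has_real_derivative \<kappa> * Z1 t x y) (at t)" for t x y
    unfolding \<Theta> Z1_def by (rule derivative_eq_intros chain_B refl | simp)+
  have Z_x: "((\<lambda>s. \<Theta> t s y) has_real_derivative Z1 t x y) (at x)" for t x y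
    unfolding \<Theta> Z1_def by (rule derivative_eq_intros chain_B refl | simp)+
  have Z_y: "((\<lambda>s. \<Theta> t x s) has_real_derivative \<kappa> * \<Theta> t x y) (at y)" for t x y
    unfolding \<Theta> by (rule derivative_eq_intros refl | simp)+
  have Z1_t: "((\<lambda>s. Z1 s x y) has_real_derivative \<kappa>\<^sup>2 * \<Theta> t x y) (at t)" for t x y
    unfolding \<Theta> Z1_def by (rule derivative_eq_intros chain_B refl | simp add: power2_eq_square)+
  have Z1_x: "((\<lambda>s. Z1 t s y) has_real_derivative \<kappa> * \<Theta> t x y) (at x)" for t x y
    unfolding \<Theta> Z1_def by (rule derivative_eq_intros chain_B refl | simp)+
  have G_t: "((\<lambda>s. G n s x y) has_real_derivative G (Suc n) t x y * (\<kappa> * Z1 t x y)) (at t)"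
    and G_x: "((\<lambda>s. G n t s y) has_real_derivative G (Suc n) t x y * Z1 t x y) (at x)"
    and G_y: "((\<lambda>s. G n t x s) has_real_derivative G (Suc n) t x y * (\<kappa> * \<Theta> t x y)) (at y)"
    for n t x y
    unfolding G_def
    by (rule DERIV_chain2[where f = "(deriv ^^ n) F"], rule F, rule \<Theta>pos, rule Z_t Z_x Z_y)+
  define f where "f = (\<lambda>t x y. F (\<Theta> t x y))"
  have f: "f = G 0" by (intro ext) (simp add: f_def G_def)
  have D1: "Dx f = (\<lambda>t x y. G 1 t x y * Z1 t x y)"
    unfolding f by (rule Dx_eqI) (use G_x[of 0] in simp)
  have D2: "Dx (Dx f) = (\<lambda>t x y. G 2 t x y * (Z1 t x y)\<^sup>2 + \<kappa> * G 1 t x y * \<Theta> t x y)"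
    unfolding D1
    by (rule Dx_eqI)
      (rule derivative_eq_intros G_x Z1_x refl
        | simp add: numeral_2_eq_2 power2_eq_square algebra_simps)+
  have D3: "Dx (Dx (Dx f)) = (\<lambda>t x y. G 3 t x y * Z1 t x y ^ 3
      + 3 * \<kappa> * G 2 t x y * \<Theta> t x y * Z1 t x y + \<kappa> * G 1 t x y * Z1 t x y)"
    unfolding D2
    by (rule Dx_eqI)
      (rule derivative_eq_intros G_x Z1_x Z_x refl
        | simp add: numeral_2_eq_2 numeral_3_eq_3 algebra_simps)+
  have D4: "Dx (Dx (Dx (Dx f))) = (\<lambda>t x y. G 4 t x y * Z1 t x y ^ 4
      + 6 * \<kappa> * G 3 t x y * (Z1 t x y)\<^sup>2 * \<Theta> t x y
      + G 2 t x y * (4 * \<kappa> * (Z1 t x y)\<^sup>2 + 3 * \<kappa>\<^sup>2 * (\<Theta> t x y)\<^sup>2)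
      + \<kappa>\<^sup>2 * G 1 t x y * \<Theta> t x y)"
    unfolding D3
    by (rule Dx_eqI)
      (rule derivative_eq_intros G_x Z1_x Z_x refl
        | simp add: eval_nat_numeral algebra_simps)+
  have Dt1: "Dt (Dx f) = (\<lambda>t x y. \<kappa> * (G 2 t x y * (Z1 t x y)\<^sup>2 + \<kappa> * G 1 t x y * \<Theta> t x y))"
    unfolding D1
    by (rule Dt_eqI)
      (rule derivative_eq_intros G_t Z1_t refl
        | simp add: numeral_2_eq_2 algebra_simps)+
  have Y1: "Dy f = (\<lambda>t x y. G 1 t x y * (\<kappa> * \<Theta> t x y))"
    unfolding f by (rule Dy_eqI) (use G_y[of 0] in simp)
  have Y2: "Dy (Dy f) = (\<lambda>t x y. \<kappa>\<^sup>2 * (G 2 t x y * (\<Theta> t x y)\<^sup>2 + G 1 t x y * \<Theta> t x y))"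
    unfolding Y1
    by (rule Dy_eqI)
      (rule derivative_eq_intros G_y Z_y refl
        | simp add: numeral_2_eq_2 algebra_simps)+
  have pows: "(Dx ^^ 2) f = Dx (Dx f)" "(Dx ^^ 4) f = Dx (Dx (Dx (Dx f)))"
    "(Dy ^^ 2) f = Dy (Dy f)"
    by (simp_all add: eval_nat_numeral)
  show "(Dx ^^ 2) (\<lambda>t x y. F (\<Theta> t x y)) =
      (\<lambda>t x y. G 2 t x y * (Z1 t x y)\<^sup>2 + \<kappa> * G 1 t x y * \<Theta> t x y)"
    using pows(1) D2 by (simp add: f_def)
  assume "KP_II_integrated (\<lambda>t x y. F (\<Theta> t x y))"
  then have "- 4 * Dt (Dx f) t x y + (Dx ^^ 4) f t x y + 6 * ((Dx ^^ 2) f t x y)\<^sup>2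
      + 3 * (Dy ^^ 2) f t x y = 0"
    by (simp add: KP_II_integrated_def f_def)
  then show "G 4 t x y * Z1 t x y ^ 4 + 6 * \<kappa> * G 3 t x y * (Z1 t x y)\<^sup>2 * \<Theta> t x y
      + G 2 t x y * (4 * \<kappa> * (Z1 t x y)\<^sup>2 + 3 * \<kappa>\<^sup>2 * (\<Theta> t x y)\<^sup>2)
      + \<kappa>\<^sup>2 * G 1 t x y * \<Theta> t x y
      - 4 * \<kappa> * (G 2 t x y * (Z1 t x y)\<^sup>2 + \<kappa> * G 1 t x y * \<Theta> t x y)
      + 6 * (G 2 t x y * (Z1 t x y)\<^sup>2 + \<kappa> * G 1 t x y * \<Theta> t x y)\<^sup>2
      + 3 * \<kappa>\<^sup>2 * (G 2 t x y * (\<Theta> t x y)\<^sup>2 + G 1 t x y * \<Theta> t x y) = 0"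
    unfolding pows D4 Dt1 Y2 unfolding D2 by (simp add: algebra_simps)
qed


section \<open>The profile\<close>

lemma zero_derivative_constant_pos:
  fixes f :: "real \<Rightarrow> real"
  assumes "\<And>s. s > 0 \<Longrightarrow> (f has_real_derivative 0) (at s)" "x > 0" "y > 0"
  shows "f x = f y"
proof -
  have "(f has_real_derivative 0) (at s within {0<..})" if "s \<in> {0<..}" for s
    using assms(1) that by (simp add: has_field_derivative_at_within)
  from has_field_derivative_zero_constant[OF convex_real_interval(3) this]
  show ?thesis using assms(2,3) by force
qed

text \<open>
  The deviation \<open>s F' - 1\<close> from the solution \<open>1 / s\<close> satisfies a linear homogeneous equation with
  coefficient \<open>-F'\<close>, for which \<open>exp F\<close> is an integrating factor. This avoids dividing by
  \<open>F'\<close>, as separation of variables would.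
\<close>

lemma riccati_profile_is_ln:
  fixes F :: "real \<Rightarrow> real"
  assumes F: "\<And>s. s > 0 \<Longrightarrow> (F has_real_derivative F1 s) (at s)"
    and F1: "\<And>s. s > 0 \<Longrightarrow> (F1 has_real_derivative - (F1 s)\<^sup>2) (at s)"
    and init: "F 1 = 0" "F1 1 = 1" and s: "s > 0"
  shows "F s = ln s" "F1 s = 1 / s"
proof -
  have "((\<lambda>s. (s * F1 s - 1) * exp (F s)) has_real_derivative 0) (at s)" if "s > 0" for s
    by (rule derivative_eq_intros F F1 refl that | simp add: algebra_simps power2_eq_square)+
  from zero_derivative_constant_pos[OF this, of _ 1]
  have F1_eq: "F1 s = 1 / s" if "s > 0" for s
    using that init by (simp add: field_simps)
  then show "F1 s = 1 / s" using s by simp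
  have "((\<lambda>s. F s - ln s) has_real_derivative 0) (at s)" if "s > 0" for s
    by (rule derivative_eq_intros F refl that | simp add: F1_eq that)+
  from zero_derivative_constant_pos[OF this, of s 1] show "F s = ln s"
    using s init by simp
qed

text \<open>
  Writing \<open>'\<close> for the derivative in \<open>\<theta> = ln s\<close>, the hypotheses read \<open>v' = w\<close>, \<open>w' = v - 6 v\<^sup>2\<close>,
  \<open>g' = v\<close>. The first integral \<open>w\<^sup>2 = v\<^sup>2 (1 - 4 v)\<close> and \<open>2 sqrt r \<le> 1 + r\<close> with \<open>r = 1 - 4 v\<close> give
  \<open>|(v\<^sup>2)'| \<le> (2 - 4 v) v\<^sup>2\<close>. The coefficient \<open>2 - 4 v\<close> has the antiderivative \<open>2 \<theta> - 4 g\<close>, so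
  multiplying \<open>v\<^sup>2\<close> by \<open>exp(\<epsilon> (2 \<theta> - 4 g))\<close> is a Gronwall argument valid without any bound on \<open>v\<close>:
  the sign \<open>\<epsilon> = -1\<close> serves for \<open>s \<ge> 1\<close> and \<open>\<epsilon> = 1\<close> for \<open>s \<le> 1\<close>.
\<close>

lemma logarithmic_soliton_ode_trivial:
  fixes v w g :: "real \<Rightarrow> real"
  assumes v: "\<And>s. s > 0 \<Longrightarrow> (v has_real_derivative w s / s) (at s)"
    and dw: "\<And>s. s > 0 \<Longrightarrow> (w has_real_derivative (v s - 6 * (v s)\<^sup>2) / s) (at s)"
    and g: "\<And>s. s > 0 \<Longrightarrow> (g has_real_derivative v s / s) (at s)"
    and init: "v 1 = 0" "w 1 = 0" and s: "s > 0"
  shows "v s = 0"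
proof -
  have "((\<lambda>s. (w s)\<^sup>2 - (v s)\<^sup>2 + 4 * v s ^ 3) has_real_derivative 0) (at s)" if "s > 0" for s
    by (rule derivative_eq_intros v dw refl that | simp)+
      (use that in \<open>simp add: field_simps power2_eq_square power3_eq_cube\<close>)
  from zero_derivative_constant_pos[OF this, of _ 1]
  have energy: "(w s)\<^sup>2 = (v s)\<^sup>2 * (1 - 4 * v s)" if "s > 0" for s
    using that init by (simp add: algebra_simps power2_eq_square power3_eq_cube)
  have bound: "\<bar>2 * v s * w s\<bar> \<le> (v s)\<^sup>2 * (2 - 4 * v s)" if "s > 0" for s
  proof (cases "v s = 0")
    case False
    have "0 \<le> (v s)\<^sup>2 * (1 - 4 * v s)" using energy[OF that] by (metis zero_le_power2)
    then have v4: "1 - 4 * v s \<ge> 0" using False by (simp add: zero_le_mult_iff)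
    have "(2 * v s * w s)\<^sup>2 = 4 * (v s)\<^sup>2 * ((v s)\<^sup>2 * (1 - 4 * v s))"
      by (simp add: power_mult_distrib energy[OF that])
    also have "\<dots> \<le> ((v s)\<^sup>2 * (2 - 4 * v s))\<^sup>2"
    proof -
      have "((v s)\<^sup>2 * (2 - 4 * v s))\<^sup>2 - 4 * (v s)\<^sup>2 * ((v s)\<^sup>2 * (1 - 4 * v s)) = (4 * v s ^ 3)\<^sup>2"
        by (simp add: algebra_simps power2_eq_square power3_eq_cube)
      then show ?thesis by (smt (verit) zero_le_power2)
    qed
    finally have "\<bar>2 * v s * w s\<bar> \<le> \<bar>(v s)\<^sup>2 * (2 - 4 * v s)\<bar>"
      by (rule abs_le_square_iff[THEN iffD2])
    also have "\<dots> = (v s)\<^sup>2 * (2 - 4 * v s)" using v4 by simp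
    finally show ?thesis .
  qed simp
  define p where "p \<epsilon> s = (v s)\<^sup>2 * exp (\<epsilon> * (2 * ln s - 4 * g s))" for \<epsilon> s
  have p: "(p \<epsilon> has_real_derivative
      (2 * v s * w s + \<epsilon> * ((v s)\<^sup>2 * (2 - 4 * v s))) * exp (\<epsilon> * (2 * ln s - 4 * g s)) / s) (at s)"
    if "s > 0" for \<epsilon> s
    unfolding p_def
    by (rule derivative_eq_intros v g refl that | simp)+
      (use that in \<open>simp add: field_simps power2_eq_square\<close>)
  have p1: "p \<epsilon> 1 = 0" for \<epsilon> by (simp add: p_def init)
  have "\<exists>\<epsilon>. p \<epsilon> s \<le> 0"
  proof (cases "s \<ge> 1")
    case True
    have "p (- 1) s \<le> p (- 1) 1"
    proof (rule DERIV_nonpos_imp_nonincreasing[OF True])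
      fix r :: real assume "1 \<le> r" "r \<le> s"
      then have r: "r > 0" by simp
      have "(2 * v r * w r + - 1 * ((v r)\<^sup>2 * (2 - 4 * v r)))
          * exp (- 1 * (2 * ln r - 4 * g r)) / r \<le> 0"
        using bound[OF r] r by (intro divide_nonpos_pos mult_nonpos_nonneg) auto
      with p[OF r] show "\<exists>y. (p (- 1) has_real_derivative y) (at r) \<and> y \<le> 0" by blast
    qed
    then show ?thesis using p1 by metis
  next
    case False
    then have "s \<le> 1" by simp
    then have "p 1 s \<le> p 1 1"
    proof (rule DERIV_nonneg_imp_nondecreasing)
      fix r :: real assume "s \<le> r" "r \<le> 1"
      with s have r: "r > 0" by simp
      have "0 \<le> (2 * v r * w r + 1 * ((v r)\<^sup>2 * (2 - 4 * v r)))
          * exp (1 * (2 * ln r - 4 * g r)) / r"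
        using bound[OF r] r by (intro divide_nonneg_pos mult_nonneg_nonneg) auto
      with p[OF r] show "\<exists>y. (p 1 has_real_derivative y) (at r) \<and> y \<ge> 0" by blast
    qed
    then show ?thesis using p1 by metis
  qed
  then have "(v s)\<^sup>2 \<le> 0" by (auto simp: p_def mult_le_0_iff)
  then show ?thesis by simp
qed


text \<open>
  The differential equation is the potential equation on \<open>\<Theta>\<^sub>x\<^sup>2 = \<kappa> \<Theta>\<^sup>2\<close>. Its left-hand side is
  \<open>(s d/ds)\<^sup>4 F\<close> and \<open>v = (s d/ds)\<^sup>2 F\<close>, so it is the equation of the preceding lemma, with
  \<open>g = s F'\<close>.
\<close>

lemma exponential_phase_profile_trivial:
  fixes F :: "real \<Rightarrow> real"
  assumes F: "\<And>n s. s > 0 \<Longrightarrow> ((deriv ^^ n) F has_real_derivative (deriv ^^ Suc n) F s) (at s)"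
    and init: "deriv F 1 = 1" "(deriv ^^ 2) F 1 = -1" "(deriv ^^ 3) F 1 = 2"
    and v_def: "\<And>s. v s = s\<^sup>2 * (deriv ^^ 2) F s + s * deriv F s"
    and ode: "\<And>s. s > 0 \<Longrightarrow>
      s ^ 4 * (deriv ^^ 4) F s + 6 * s ^ 3 * (deriv ^^ 3) F s + 7 * s\<^sup>2 * (deriv ^^ 2) F s
        + s * deriv F s = v s - 6 * (v s)\<^sup>2"
    and s: "s > 0"
  shows "v s = 0"
proof -
  have F1: "(deriv F has_real_derivative (deriv ^^ 2) F s) (at s)"
    and F2: "((deriv ^^ 2) F has_real_derivative (deriv ^^ 3) F s) (at s)"
    and F3: "((deriv ^^ 3) F has_real_derivative (deriv ^^ 4) F s) (at s)"
    if "s > 0" for s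
    using F[OF that, of 1] F[OF that, of 2] F[OF that, of 3] by (simp_all add: eval_nat_numeral)
  define v1 where "v1 s = s ^ 3 * (deriv ^^ 3) F s + 3 * s\<^sup>2 * (deriv ^^ 2) F s + s * deriv F s" for s
  have v_fun: "v = (\<lambda>s. s\<^sup>2 * (deriv ^^ 2) F s + s * deriv F s)" by (rule ext) (rule v_def)
  show ?thesis
  proof (rule logarithmic_soliton_ode_trivial[where v = v and w = v1 and g = "\<lambda>s. s * deriv F s"])
    fix s :: real assume s: "s > 0"
    show "(v has_real_derivative v1 s / s) (at s)"
      unfolding v_fun v1_def
      by (rule derivative_eq_intros F1[OF s] F2[OF s] refl | simp)+
        (use s in \<open>simp add: field_simps power2_eq_square power3_eq_cube\<close>)
    show "(v1 has_real_derivative (v s - 6 * (v s)\<^sup>2) / s) (at s)"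
      unfolding v1_def ode[OF s, symmetric]
      by (rule derivative_eq_intros F1[OF s] F2[OF s] F3[OF s] refl | simp)+
        (use s in \<open>simp add: field_simps eval_nat_numeral\<close>)
    show "((\<lambda>s. s * deriv F s) has_real_derivative v s / s) (at s)"
      unfolding v_def
      by (rule derivative_eq_intros F1[OF s] refl | simp)+
        (use s in \<open>simp add: field_simps power2_eq_square\<close>)
  qed (use s in \<open>simp_all add: v_def v1_def init\<close>)
qed

lemma exponential_sum_eq_shifted_cosh:
  fixes a b c :: real
  assumes "a > 0" "b > 0" "c \<noteq> 0"
  obtains r x0 where
    "\<And>x. a * exp (c * x) + b * exp (- (c * x)) = r * cosh (c * (x - x0))"
    "\<And>x. a * exp (c * x) - b * exp (- (c * x)) = r * sinh (c * (x - x0))"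
proof -
  \<comment> \<open>The centre \<open>x0\<close> balances the two exponentials: \<open>a * exp (c * x0) = b * exp (- (c * x0))\<close>.\<close>
  define q where "q = sqrt (b / a)"
  define x0 where "x0 = ln q / c"
  have q: "q > 0" "q * q = b / a" using assms by (simp_all add: q_def)
  have x0: "exp (c * x0) = q" using assms(3) q(1) by (simp add: x0_def)
  have "exp (c * (x - x0)) = exp (c * x) / q" "exp (- (c * (x - x0))) = exp (- (c * x)) * q" for x
    using exp_diff[of "c * x" "c * x0"] exp_add[of "- (c * x)" "c * x0"]
    by (simp_all add: x0 right_diff_distrib)
  moreover have "b = a * q * q" using q(2) assms(1) by (simp add: mult.assoc)
  ultimately have "a * exp (c * x) + b * exp (- (c * x)) = 2 * a * q * cosh (c * (x - x0))"
    "a * exp (c * x) - b * exp (- (c * x)) = 2 * a * q * sinh (c * (x - x0))" for x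
    unfolding cosh_def sinh_def using q(1)
    by (simp_all only: real_scaleR_def) (simp_all add: field_simps)
  then show ?thesis using that[of "2 * a * q" x0] by simp
qed


section \<open>Rigidity of the line soliton\<close>

theorem corollary1p7:
  fixes F :: "real \<Rightarrow> real"
    and I :: "real set"
    and \<Theta> u :: "real \<Rightarrow> real \<Rightarrow> real \<Rightarrow> real"
  assumes I: "open I" "1 \<in> I" "I \<subseteq> {0<..}"
    and F_smooth: "smooth_on I F"
    and F_init: "F 1 = 0" "deriv F 1 = 1" "(deriv ^^ 2) F 1 = -1" "(deriv ^^ 3) F 1 = 2"
    and \<Theta>_smooth: "smooth3 \<Theta>"
    and \<Theta>_range: "\<And>t x y. \<Theta> t x y \<in> I"
    and \<Theta>_heat: "\<And>t x y. heat_op \<Theta> t x y = 0"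
    and \<Theta>_airy: "\<And>t x y. airy_op \<Theta> t x y = 0"
    and \<Theta>_Wy: "\<And>t x y. Wy_op \<Theta> t x y = 0"
    and u_form: "\<And>t x y. u t x y = 2 * (Dx ^^ 2) (\<lambda>t x y. F (\<Theta> t x y)) t x y"
    and u_KP: "KP_II u"
    and f_KP: "KP_II_integrated (\<lambda>t x y. F (\<Theta> t x y))"
    and u_nontrivial: "\<exists>t x y. u t x y \<noteq> 0"
  shows "(\<forall>s\<in>I. F s = ln s) \<and>
         (\<exists>k x\<^sub>0. k \<noteq> 0 \<and> (\<forall>t x y. u t x y = Q k t (x - x\<^sub>0)))"
proof -
  have \<Theta>_pos: "\<Theta> t x y > 0" for t x y using \<Theta>_range I(3) by fastforce
  obtain \<kappa> B B1 where \<Theta>: "\<And>t x y. \<Theta> t x y = B (x + \<kappa> * t) * exp (\<kappa> * y)"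
    and Bpos: "\<And>x. B x > 0"
    and B: "\<And>x. (B has_real_derivative B1 x) (at x)"
    and B1: "\<And>x. (B1 has_real_derivative \<kappa> * B x) (at x)"
    by (rule phase_separates[OF \<Theta>_smooth \<Theta>_pos \<Theta>_heat \<Theta>_airy \<Theta>_Wy]) blast
  have "\<kappa> \<noteq> 0"
  proof
    assume \<kappa>: "\<kappa> = 0"
    have "(B has_real_derivative 0) (at x)" for x
      using B[of x] positive_affine_constant[OF Bpos B, of x] B1 by (simp add: \<kappa>)
    then have "B x = B 0" for x by (rule zero_derivative_constant)
    then have "\<Theta> = (\<lambda>t x y. B 0)" by (intro ext) (simp add: \<Theta> \<kappa>)
    then have "u t x y = 0" for t x y by (simp add: u_form Dx_def numeral_2_eq_2)
    with u_nontrivial show False by simp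
  qed
  with positive_solution_eigenvalue_nonneg[OF Bpos B B1] have "\<kappa> > 0" by simp
  define c where "c = sqrt \<kappa>"
  have c: "c > 0" "\<kappa> = c\<^sup>2" using \<open>\<kappa> > 0\<close> by (simp_all add: c_def)
  have surj: "\<exists>y. \<Theta> 0 x y = s" if "s > 0" for s x
    using that \<open>\<kappa> > 0\<close> Bpos[of x]
    by (intro exI[of _ "ln (s / B x) / \<kappa>"]) (simp add: \<Theta>)
  then have I_eq: "I = {0<..}" using I(3) \<Theta>_range by (metis greaterThan_iff subsetI subset_antisym)
  have F: "((deriv ^^ n) F has_real_derivative (deriv ^^ Suc n) F s) (at s)" if "s > 0" for n s
    by (rule smooth_on_has_iterated_deriv[OF I(1) F_smooth]) (use that in \<open>simp add: I_eq\<close>)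
  define Z1 where "Z1 t x y = B1 (x + \<kappa> * t) * exp (\<kappa> * y)" for t x y
  define G where "G n t x y = (deriv ^^ n) F (\<Theta> t x y)" for n t x y
  have u: "u t x y = 2 * (G 2 t x y * (Z1 t x y)\<^sup>2 + \<kappa> * G 1 t x y * \<Theta> t x y)" for t x y
    unfolding u_form using separated_phase_Dxx[OF \<Theta> Bpos B B1 F Z1_def G_def] by simp
  note eq = separated_phase_potential_equation[OF \<Theta> Bpos B B1 F Z1_def G_def f_KP]
  obtain a b where ab: "a \<ge> 0" "b \<ge> 0"
    and Bab: "\<And>x. B x = a * exp (c * x) + b * exp (- (c * x))"
    and B1ab: "\<And>x. B1 x = c * (a * exp (c * x) - b * exp (- (c * x)))"
    by (rule positive_hyperbolic_solution[OF Bpos _ B B1[unfolded c(2)]]) (use c(1) in blast)+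
  have "a * b \<noteq> 0"
  proof
    assume "a * b = 0"
    then have "(B1 x)\<^sup>2 = \<kappa> * (B x)\<^sup>2" for x
      by (auto simp: Bab B1ab c(2) power_mult_distrib)
    then have Z1: "(Z1 t x y)\<^sup>2 = \<kappa> * (\<Theta> t x y)\<^sup>2" for t x y
      by (simp add: Z1_def \<Theta> power_mult_distrib)
    define v where "v s = s\<^sup>2 * (deriv ^^ 2) F s + s * deriv F s" for s
    have "v s = 0" if "s > 0" for s
    proof (rule exponential_phase_profile_trivial[OF F F_init(2-4) v_def _ that])
      fix s :: real assume "s > 0"
      then obtain y where y: "\<Theta> 0 0 y = s" using surj by blast
      have Z4: "Z1 0 0 y ^ 4 = \<kappa>\<^sup>2 * s ^ 4"
      proof -
        have "Z1 0 0 y ^ 4 = ((Z1 0 0 y)\<^sup>2)\<^sup>2" by simp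
        then show ?thesis by (simp add: Z1 y power_mult_distrib)
      qed
      have "\<kappa>\<^sup>2 * (s ^ 4 * (deriv ^^ 4) F s + 6 * s ^ 3 * (deriv ^^ 3) F s
          + 7 * s\<^sup>2 * (deriv ^^ 2) F s + s * deriv F s - v s + 6 * (v s)\<^sup>2) = 0"
        using eq[of 0 0 y] unfolding Z4 Z1 G_def y v_def
        by (simp add: algebra_simps power2_eq_square power3_eq_cube)
      then show "s ^ 4 * (deriv ^^ 4) F s + 6 * s ^ 3 * (deriv ^^ 3) F s
          + 7 * s\<^sup>2 * (deriv ^^ 2) F s + s * deriv F s = v s - 6 * (v s)\<^sup>2"
        using \<open>\<kappa> \<noteq> 0\<close> by simp
    qed
    moreover have "u t x y = 2 * \<kappa> * v (\<Theta> t x y)" for t x y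
      by (simp add: u Z1 G_def v_def algebra_simps)
    ultimately show False using u_nontrivial \<Theta>_pos by simp
  qed
  with ab have "a > 0" "b > 0" by auto
  then obtain r x0 where Bcosh: "\<And>x. B x = r * cosh (c * (x - x0))"
    and B1sinh: "\<And>x. B1 x = c * (r * sinh (c * (x - x0)))"
    using exponential_sum_eq_shifted_cosh[of a b c] c(1) unfolding Bab B1ab by auto
  have F1: "(F has_real_derivative deriv F s) (at s)" if "s > 0" for s
    using F[OF that, of 0] by simp
  have riccati: "(deriv ^^ 2) F s = - (deriv F s)\<^sup>2" if s: "s > 0" for s
  proof -
    obtain y where y: "\<Theta> 0 x0 y = s" using surj[OF s] by blast
    have "Z1 0 x0 y = 0" by (simp add: Z1_def B1sinh)
    then have "6 * \<kappa>\<^sup>2 * s\<^sup>2 * ((deriv ^^ 2) F s + (deriv F s)\<^sup>2) = 0"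
      using eq[of 0 x0 y] unfolding G_def y by (simp add: algebra_simps power2_eq_square)
    then show ?thesis using s \<open>\<kappa> \<noteq> 0\<close> by simp
  qed
  have F2: "(deriv F has_real_derivative - (deriv F s)\<^sup>2) (at s)" if "s > 0" for s
    using F[OF that, of 1] riccati[OF that] by (simp add: numeral_2_eq_2)
  have F_ln: "F s = ln s" "deriv F s = 1 / s" if "s > 0" for s
    using riccati_profile_is_ln[of F "deriv F" s] F1 F2 F_init(1,2) that by blast+
  have "u t x y = Q c t (x - x0)" for t x y
  proof -
    define w where "w = c * (x + \<kappa> * t - x0)"
    have w: "c * (x - x0) + c ^ 3 * t = w"
      by (simp add: w_def c(2) algebra_simps power2_eq_square power3_eq_cube)
    have Z1: "Z1 t x y = c * (sinh w / cosh w) * \<Theta> t x y"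
      by (simp add: Z1_def \<Theta> Bcosh B1sinh w_def)
    have G1: "G 1 t x y = 1 / \<Theta> t x y" and G2: "G 2 t x y = - (1 / \<Theta> t x y)\<^sup>2"
      using F_ln(2)[OF \<Theta>_pos] riccati[OF \<Theta>_pos] by (simp_all add: G_def)
    have nz: "\<Theta> t x y \<noteq> 0" using \<Theta>_pos[of t x y] by simp
    have "u t x y = 2 * c\<^sup>2 * (1 - (sinh w)\<^sup>2 / (cosh w)\<^sup>2)"
      unfolding u Z1 G1 G2 c(2) using nz by (simp add: power_mult_distrib power_divide algebra_simps)
    also have "1 - (sinh w)\<^sup>2 / (cosh w)\<^sup>2 = 1 / (cosh w)\<^sup>2"
      using cosh_real_nonzero[of w] by (simp add: diff_divide_eq_iff sinh_square_eq)
    finally show ?thesis by (simp add: Q_def sech_def w power_divide)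
  qed
  moreover have "\<forall>s\<in>I. F s = ln s" using F_ln(1) by (simp add: I_eq)
  ultimately show ?thesis using c(1) by (intro conjI exI[of _ c] exI[of _ x0]) auto
qed

end
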